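(* Let $n\ge 0$ and let $m_0>m_1>\cdots>m_n\ge 0$ be integers. Let $V\subseteq\mathbb{R}[t]$ be the linear span of $t^{m_0},\dots,t^{m_n}$. Put $k=\lfloor n/2\rfloor$, assume $m_0>2k$, and write $\Sigma=\Sigma_{2k}=\{g\in\mathbb{R}[t] : \deg(g)\le 2k,\ g\ge 0\text{ on }\mathbb{R}\}$. Let (a) $I=[0,1]$ or (b) $I=[0,\infty[$, and let $P=\{f\in V : f\ge 0\text{ on }I\}$. Then, respectively, $$\text{(a)}\quad P\subseteq\bigl(\Sigma+t\Sigma+\cdots+t^{m_0-2k}\Sigma\bigr)+(1-t)\bigl(\Sigma+t\Sigma+\cdots+t^{m_0-2k-1}\Sigma\bigr),$$ $$\text{(b)}\quad P\subseteq\Sigma+t\Sigma+\cdots+t^{m_0-2k}\Sigma .$$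
   Context: For a set $\Sigma$ of polynomials, $t^i\Sigma=\{t^ig: g\in\Sigma\}$, and sums of sets are Minkowski sums. *)

theory Defs
  imports "HOL-Computational_Algebra.Polynomial" "HOL-Library.Set_Algebras"
begin

text \<open>
  Via \<^theory>\<open>HOL-Library.Set_Algebras\<close>, \<open>+\<close> and \<open>\<Sum>\<close> on sets are Minkowski sums
  (the empty sum being \<open>{0}\<close>), and \<open>h *o S\<close> is the set of all \<open>h * g\<close> with \<open>g \<in> S\<close>.
\<close>

definition psd_polys :: "nat \<Rightarrow> real poly set" where
  "psd_polys d = {g. degree g \<le> d \<and> (\<forall>x. poly g x \<ge> 0)}"

text \<open>The type of real polynomials carries no \<^class>\<open>real_vector\<close> instance;
  the linear span is the one for the scalar multiplication \<^const>\<open>smult\<close>.\<close>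

lemma vector_space_smult: "vector_space (smult :: real \<Rightarrow> _)"
  by unfold_locales (simp_all add: smult_add_left smult_add_right)

definition monomial_span :: "nat set \<Rightarrow> real poly set" where
  "monomial_span E = module.span smult (monom 1 ` E)"

definition nonneg_polys_on :: "real set \<Rightarrow> real poly set \<Rightarrow> real poly set" where
  "nonneg_polys_on I V = {f \<in> V. \<forall>x\<in>I. poly f x \<ge> 0}"

definition shifted_sum :: "nat \<Rightarrow> real poly set \<Rightarrow> real poly set" where
  "shifted_sum r S = (\<Sum>i\<le>r. monom 1 i *o S)"

end

theory Submission
  imports Defs
begin

text \<open>
  Every \<open>f \<in> P\<close> is a sum of extremal elements of \<open>P\<close>: if \<open>\<bar>g\<bar> \<le> c f\<close> on \<open>I\<close> for some \<open>g \<in> V\<close> that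
  is not a multiple of \<open>f\<close>, then \<open>f\<close> splits into two elements with smaller spaces of dominated
  polynomials. Write an extremal \<open>f\<close> as \<open>p\<^sup>2 (1 - t)\<^sup>b h\<close> with \<open>b \<le> 1\<close>, where \<open>p\<close> has only positive
  roots and \<open>h\<close> has no root in \<open>I\<close> except possibly \<open>0\<close>. By extremality \<open>f\<close> has at most
  \<open>2 deg p + b + 1\<close> terms, and by Descartes' rule this number of positive roots forces all
  coefficients of \<open>h\<close> to be nonnegative. So \<open>f\<close> is a nonnegative combination of the polynomials
  \<open>t\<^sup>j p\<^sup>2 (1 - t)\<^sup>b\<close>, which lie in the right hand sides.
\<close>

section \<open>Supports of polynomials and monomial spans\<close>

definition poly_supp :: "real poly \<Rightarrow> nat set" where
  "poly_supp f = {i. coeff f i \<noteq> 0}"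

lemma finite_poly_supp [simp]: "finite (poly_supp f)"
  by (rule finite_subset[of _ "{..degree f}"]) (auto simp: poly_supp_def le_degree)

lemma poly_supp_add: "poly_supp (f + g) \<subseteq> poly_supp f \<union> poly_supp g"
  by (auto simp: poly_supp_def)

lemma poly_supp_diff: "poly_supp (f - g) \<subseteq> poly_supp f \<union> poly_supp g"
  by (auto simp: poly_supp_def)

lemma poly_supp_smult: "poly_supp (smult c f) \<subseteq> poly_supp f"
  by (auto simp: poly_supp_def)

text \<open>The polynomials supported in \<open>E\<close> form a subspace containing the spanning
  monomials. Membership in the span enters the later arguments only through this inclusion.\<close>

lemma poly_supp_monomial_span:
  assumes "f \<in> monomial_span E"
  shows "poly_supp f \<subseteq> E"
proof -
  interpret vector_space "smult :: real \<Rightarrow> real poly \<Rightarrow> real poly"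
    by (rule vector_space_smult)
  have "subspace {f. poly_supp f \<subseteq> E}"
    unfolding subspace_def
    using poly_supp_add poly_supp_smult by (auto simp: poly_supp_def[of 0]) blast+
  moreover have "monom 1 ` E \<subseteq> {f. poly_supp f \<subseteq> E}"
    by (auto simp: poly_supp_def split: if_splits)
  ultimately have "span (monom 1 ` E) \<subseteq> {f. poly_supp f \<subseteq> E}"
    by (intro span_minimal)
  with assms show ?thesis by (auto simp: monomial_span_def)
qed

section \<open>Sign changes\<close>

text \<open>At least \<open>v\<close> sign changes in the coefficient sequence, witnessed by a
  selection \<open>i\<close> of \<open>v + 1\<close> coefficients. Only the sign of
  \<open>\<sigma>\<close> matters; it lets the pattern start with either sign.\<close>

definition alternating :: "nat \<Rightarrow> real poly \<Rightarrow> bool" where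
  "alternating v h \<longleftrightarrow>
     (\<exists>\<sigma> i. strict_mono_on {..v} i \<and> (\<forall>s\<le>v. \<sigma> * (-1) ^ s * coeff h (i s) > 0))"

lemma alternating_card_supp:
  assumes "alternating v h"
  shows "Suc v \<le> card (poly_supp h)"
proof -
  obtain \<sigma> i where i: "strict_mono_on {..v} i" "\<forall>s\<le>v. \<sigma> * (-1) ^ s * coeff h (i s) > 0"
    using assms by (auto simp: alternating_def)
  have "card {..v} \<le> card (poly_supp h)"
  proof (rule card_inj_on_le)
    show "inj_on i {..v}" using i(1) by (rule strict_mono_on_imp_inj_on)
    show "i ` {..v} \<subseteq> poly_supp h" using i(2) by (force simp: poly_supp_def)
  qed simp
  then show ?thesis by simp
qed

lemma alternating_0:
  assumes "h \<noteq> 0"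
  shows "alternating 0 h"
  unfolding alternating_def
proof (intro exI conjI allI impI)
  show "strict_mono_on {..0} (\<lambda>_::nat. degree h)" by (auto simp: strict_mono_on_def)
  show "0 < lead_coeff h * (-1) ^ s * coeff h (degree h)" if "s \<le> 0" for s :: nat
    using that assms by (simp flip: power2_eq_square)
qed

lemma alternating_1:
  assumes "coeff h i * coeff h j < 0"
  shows "alternating 1 h"
proof -
  have *: "alternating 1 h" if ij: "i < j" and neg: "coeff h i * coeff h j < 0" for i j
    unfolding alternating_def
  proof (intro exI conjI allI impI)
    show "strict_mono_on {..1} (\<lambda>s::nat. if s = 0 then i else j)"
      using ij by (auto simp: strict_mono_on_def)
    fix s :: nat assume "s \<le> 1"
    then consider "s = 0" | "s = 1" by linarith
    then show "0 < coeff h i * (-1) ^ s * coeff h (if s = 0 then i else j)"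
      using neg by cases (simp_all add: mult_less_0_iff zero_less_mult_iff, linarith)
  qed
  have "i \<noteq> j" using assms by (auto simp: mult_less_0_iff)
  then show ?thesis
    using *[of i j] *[of j i] assms by (auto simp: mult.commute neq_iff)
qed

lemma alternating_uminus:
  assumes "alternating v h"
  shows "alternating v (- h)"
proof -
  obtain \<sigma> i where "strict_mono_on {..v} i" "\<forall>s\<le>v. \<sigma> * (-1) ^ s * coeff h (i s) > 0"
    using assms by (auto simp: alternating_def)
  then have "strict_mono_on {..v} i \<and> (\<forall>s\<le>v. (-\<sigma>) * (-1) ^ s * coeff (-h) (i s) > 0)"
    by simp
  then show ?thesis unfolding alternating_def by blast
qed

text \<open>The new indices \<open>j\<close> interlace the given ones: \<open>j 0 \<le> i 0 < j 1 \<le> i 1 < \<dots> \<le> i v < j (Suc v)\<close>.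
  Each one is placed where the sign of the coefficients of \<open>h\<close> flips.\<close>

lemma alternating_linear_mult:
  assumes "\<xi> > 0" "alternating v h"
  shows "alternating (Suc v) ([:-\<xi>, 1:] * h)"
proof -
  obtain \<sigma> i where i: "strict_mono_on {..v} i" "\<forall>s\<le>v. \<sigma> * (-1) ^ s * coeff h (i s) > 0"
    using assms(2) by (auto simp: alternating_def)
  define c where "c = coeff ([:-\<xi>, 1:] * h)"
  have c_0: "c 0 = - \<xi> * coeff h 0" by (simp add: c_def)
  have c_Suc: "c (Suc j) = coeff h j - \<xi> * coeff h (Suc j)" for j
    by (simp add: c_def)
  \<comment> \<open>Take the least index after \<open>i (s - 1)\<close> whose coefficient has the
    sign of the one at \<open>i s\<close>. Its predecessor has the opposite sign or is zero, so
    \<open>c_Suc\<close> fixes the sign of \<open>c\<close> there.\<close>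
  have low: "\<exists>j. (0 < s \<longrightarrow> i (s - 1) < j) \<and> j \<le> i s \<and> (-\<sigma>) * (-1) ^ s * c j > 0"
    if s: "s \<le> v" for s
  proof -
    define \<tau> where "\<tau> = \<sigma> * (-1) ^ s"
    define Q where "Q j \<longleftrightarrow> (0 < s \<longrightarrow> i (s - 1) < j) \<and> \<tau> * coeff h j > 0" for j
    have prev: "\<tau> * coeff h (i (s - 1)) < 0" if "0 < s"
    proof -
      from \<open>0 < s\<close> obtain r where r: "s = Suc r" by (cases s) auto
      have "\<sigma> * (-1) ^ r * coeff h (i r) > 0" using i(2) r s by simp
      then show ?thesis by (simp add: \<tau>_def r)
    qed
    have "Q (i s)"
      using i(2) s strict_mono_onD[OF i(1), of "s - 1" s] by (simp add: Q_def \<tau>_def)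
    define j where "j = (LEAST j. Q j)"
    have "Q j" "j \<le> i s"
      unfolding j_def using \<open>Q (i s)\<close> by (auto intro: LeastI Least_le)
    moreover have "\<tau> * c j < 0"
    proof (cases j)
      case 0
      then show ?thesis using \<open>Q j\<close> \<open>\<xi> > 0\<close>
        by (simp add: c_0 Q_def mult_less_0_iff zero_less_mult_iff)
    next
      case (Suc j')
      have "\<not> Q j'"
        using Suc unfolding j_def by (metis lessI not_less_Least)
      moreover have "i (s - 1) = j' \<or> i (s - 1) < j'" if "0 < s"
        using \<open>Q j\<close> Suc that by (auto simp: Q_def)
      ultimately have "\<tau> * coeff h j' \<le> 0"
        using prev by (force simp: Q_def)
      moreover have "\<xi> * (\<tau> * coeff h j) > 0"
        using \<open>Q j\<close> \<open>\<xi> > 0\<close> by (simp add: Q_def)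
      ultimately show ?thesis using Suc by (simp add: c_Suc algebra_simps)
    qed
    ultimately show ?thesis by (intro exI[of _ j]) (auto simp: Q_def \<tau>_def)
  qed
  \<comment> \<open>The extra sign comes from the first index beyond \<open>i v\<close> where the
    sign of the coefficient at \<open>i v\<close> is lost. It exists because coefficients vanish
    beyond the degree.\<close>
  have high: "\<exists>j. i v < j \<and> (-\<sigma>) * (-1) ^ Suc v * c j > 0"
  proof -
    define \<tau> where "\<tau> = \<sigma> * (-1) ^ v"
    define Q where "Q j \<longleftrightarrow> i v < j \<and> \<tau> * coeff h j \<le> 0" for j
    have "Q (Suc (max (i v) (degree h)))"
      by (auto simp: Q_def coeff_eq_0)
    define j where "j = (LEAST j. Q j)"
    have "Q j"
      unfolding j_def using \<open>Q (Suc _)\<close> by (rule LeastI)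
    then obtain j' where j': "j = Suc j'" by (cases j) (auto simp: Q_def)
    then have "\<not> Q j'"
      unfolding j_def by (metis lessI not_less_Least)
    then have "\<tau> * coeff h j' > 0"
      using \<open>Q j\<close> j' i(2) by (cases "i v = j'") (auto simp: Q_def \<tau>_def)
    moreover have "\<xi> * (\<tau> * coeff h j) \<le> 0"
      using \<open>Q j\<close> \<open>\<xi> > 0\<close> by (simp add: Q_def mult_le_0_iff)
    ultimately have "\<tau> * c j > 0" by (simp add: j' c_Suc algebra_simps)
    then show ?thesis using \<open>Q j\<close> by (intro exI[of _ j]) (auto simp: Q_def \<tau>_def)
  qed
  have "\<forall>s\<le>Suc v. \<exists>j. (0 < s \<longrightarrow> i (s - 1) < j) \<and> (s \<le> v \<longrightarrow> j \<le> i s) \<and> (-\<sigma>) * (-1) ^ s * c j > 0"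
  proof (intro allI impI)
    fix s assume "s \<le> Suc v"
    then show "\<exists>j. (0 < s \<longrightarrow> i (s - 1) < j) \<and> (s \<le> v \<longrightarrow> j \<le> i s) \<and> (-\<sigma>) * (-1) ^ s * c j > 0"
      using low[of s] high by (cases "s = Suc v") auto
  qed
  then obtain j where j: "\<And>s. s \<le> Suc v \<Longrightarrow> (0 < s \<longrightarrow> i (s - 1) < j s) \<and>
      (s \<le> v \<longrightarrow> j s \<le> i s) \<and> (-\<sigma>) * (-1) ^ s * c (j s) > 0"
    by metis
  have "strict_mono_on {..Suc v} j"
  proof (rule strict_mono_onI)
    fix r s assume rs: "r \<in> {..Suc v}" "s \<in> {..Suc v}" "r < s"
    have "j r \<le> i r" using j[of r] rs by auto
    also have "i r \<le> i (s - 1)"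
      using rs by (intro strict_mono_on_leD[OF i(1)]) auto
    also have "i (s - 1) < j s" using j[of s] rs by auto
    finally show "j r < j s" .
  qed
  then show ?thesis
    unfolding alternating_def c_def[symmetric] using j by blast
qed

text \<open>Products of linear polynomials with positive roots have this property;
  this is Descartes' rule of signs.\<close>

definition sign_gaining :: "real poly \<Rightarrow> bool" where
  "sign_gaining q \<longleftrightarrow>
     q \<noteq> 0 \<and> (\<forall>v h. alternating v h \<longrightarrow> alternating (v + degree q) (q * h))"

lemma sign_gaining_1 [simp]: "sign_gaining 1"
  by (simp add: sign_gaining_def)

lemma sign_gaining_linear: "\<xi> > 0 \<Longrightarrow> sign_gaining [:-\<xi>, 1:]"
  using alternating_linear_mult by (simp add: sign_gaining_def)

lemma sign_gaining_uminus: "sign_gaining q \<Longrightarrow> sign_gaining (- q)"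
  by (auto simp: sign_gaining_def alternating_uminus)

lemma sign_gaining_one_minus: "sign_gaining [:1, -1:]"
  using sign_gaining_uminus[OF sign_gaining_linear[of 1]] by simp

lemma sign_gaining_mult:
  assumes "sign_gaining p" "sign_gaining q"
  shows "sign_gaining (p * q)"
  unfolding sign_gaining_def
proof (intro conjI allI impI)
  show "p * q \<noteq> 0" using assms by (simp add: sign_gaining_def)
  fix v h assume "alternating v h"
  then have "alternating (v + degree q + degree p) (p * (q * h))"
    using assms by (simp add: sign_gaining_def)
  then show "alternating (v + degree (p * q)) (p * q * h)"
    using assms by (simp add: sign_gaining_def degree_mult_eq ac_simps)
qed

lemma sign_gaining_power: "sign_gaining q \<Longrightarrow> sign_gaining (q ^ k)"
  by (induction k) (auto intro: sign_gaining_mult)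

text \<open>A single nonzero coefficient of \<open>h\<close> is an alternating pattern with no sign
  change; multiplying by \<open>q\<close> adds \<open>degree q\<close> changes. This later bounds
  degrees by the number of terms.\<close>

lemma sign_gaining_card_supp:
  assumes "sign_gaining q" "h \<noteq> 0"
  shows "Suc (degree q) \<le> card (poly_supp (q * h))"
proof -
  have "alternating (0 + degree q) (q * h)"
    using assms alternating_0[of h] unfolding sign_gaining_def by blast
  then show ?thesis using alternating_card_supp by simp
qed

text \<open>Coefficients of both signs in \<open>h\<close> would give \<open>q * h\<close> at least
  \<open>degree q + 1\<close> sign changes, hence one term too many. The value at 1 then decides
  which sign occurs.\<close>

lemma sign_gaining_cofactor_coeffs:
  assumes "sign_gaining q" "card (poly_supp (q * h)) \<le> Suc (degree q)" "poly h 1 > 0"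
  shows "coeff h i \<ge> 0"
proof (rule ccontr)
  assume "\<not> coeff h i \<ge> 0"
  have "coeff h j \<le> 0" for j
  proof (rule ccontr)
    assume "\<not> coeff h j \<le> 0"
    with \<open>\<not> coeff h i \<ge> 0\<close> have "alternating 1 h"
      by (intro alternating_1[of _ i j]) (simp add: mult_neg_pos)
    then have "alternating (1 + degree q) (q * h)"
      using assms(1) unfolding sign_gaining_def by blast
    then show False using alternating_card_supp assms(2) by force
  qed
  then have "poly h 1 \<le> 0" by (simp add: poly_altdef sum_nonpos)
  with assms(3) show False by simp
qed

section \<open>Extremal decomposition\<close>

lemma poly_eq_if_eq_on_infinite:
  fixes f g :: "real poly"
  assumes "infinite I" "\<And>x. x \<in> I \<Longrightarrow> poly f x = poly g x"
  shows "f = g"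
proof (rule ccontr)
  assume "f \<noteq> g"
  then have "finite {x. poly (f - g) x = 0}" by (intro poly_roots_finite) simp
  moreover have "I \<subseteq> {x. poly (f - g) x = 0}" using assms(2) by auto
  ultimately show False using assms(1) finite_subset by blast
qed

text \<open>For \<open>f\<close> supported in \<open>E\<close> and nonnegative on \<open>I\<close>,
  this is the linear span of the face generated by \<open>f\<close> in the cone of such polynomials.
  For nonzero \<open>f\<close>, extremality means that this space is the line through
  \<open>f\<close>.\<close>

definition dominated :: "nat set \<Rightarrow> real set \<Rightarrow> real poly \<Rightarrow> real poly set" where
  "dominated E I f =
     {g. poly_supp g \<subseteq> E \<and> (\<exists>c. \<forall>x\<in>I. \<bar>poly g x\<bar> \<le> c * poly f x)}"

lemma dominated_zero: "0 \<in> dominated E I f"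
  by (auto simp: dominated_def poly_supp_def intro!: exI[of _ 0])

lemma dominated_smult:
  assumes "g \<in> dominated E I f"
  shows "smult a g \<in> dominated E I f"
proof -
  obtain c where "\<forall>x\<in>I. \<bar>poly g x\<bar> \<le> c * poly f x"
    using assms by (auto simp: dominated_def)
  then have "\<forall>x\<in>I. \<bar>poly (smult a g) x\<bar> \<le> (\<bar>a\<bar> * c) * poly f x"
    by (auto simp: abs_mult mult.assoc intro: mult_left_mono)
  then show ?thesis using assms poly_supp_smult[of a g] by (auto simp: dominated_def)
qed

lemma dominated_add:
  assumes "g \<in> dominated E I f" "h \<in> dominated E I f"
  shows "g + h \<in> dominated E I f"
proof -
  obtain c d where "\<forall>x\<in>I. \<bar>poly g x\<bar> \<le> c * poly f x" "\<forall>x\<in>I. \<bar>poly h x\<bar> \<le> d * poly f x"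
    using assms by (auto simp: dominated_def)
  then have "\<forall>x\<in>I. \<bar>poly (g + h) x\<bar> \<le> (c + d) * poly f x"
    by (fastforce simp: algebra_simps)
  then show ?thesis using assms poly_supp_add[of g h] by (auto simp: dominated_def)
qed

lemma dominated_diff:
  "g \<in> dominated E I f \<Longrightarrow> h \<in> dominated E I f \<Longrightarrow> g - h \<in> dominated E I f"
  using dominated_add[of g E I f "smult (-1) h"] dominated_smult[of h E I f "-1"] by simp

lemma dominated_refl:
  assumes "poly_supp f \<subseteq> E" "\<And>x. x \<in> I \<Longrightarrow> poly f x \<ge> 0"
  shows "f \<in> dominated E I f"
  using assms by (auto simp: dominated_def intro!: exI[of _ 1])

lemma dominated_trans:
  assumes "g \<in> dominated E I f" "\<And>x. x \<in> I \<Longrightarrow> poly g x \<ge> 0"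
  shows "dominated E I g \<subseteq> dominated E I f"
proof
  fix h assume h: "h \<in> dominated E I g"
  obtain c d where cd: "\<forall>x\<in>I. \<bar>poly g x\<bar> \<le> c * poly f x" "\<forall>x\<in>I. \<bar>poly h x\<bar> \<le> d * poly g x"
    using assms h by (auto simp: dominated_def)
  \<comment> \<open>Passing to \<open>\<bar>d\<bar>\<close> makes the factor nonnegative, so that
    the bound for \<open>g\<close> can be multiplied by it.\<close>
  have "\<bar>poly h x\<bar> \<le> (\<bar>d\<bar> * c) * poly f x" if "x \<in> I" for x
  proof -
    have "\<bar>poly h x\<bar> \<le> \<bar>d\<bar> * poly g x"
      using cd(2) that assms(2)[OF that] by (smt (verit) mult_right_mono)
    also have "\<dots> \<le> \<bar>d\<bar> * (c * poly f x)"
      using cd(1) that by (intro mult_left_mono) fastforce+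
    finally show ?thesis by (simp add: mult.assoc)
  qed
  then show "h \<in> dominated E I f" using h by (auto simp: dominated_def)
qed

text \<open>The number of degrees of nonzero elements equals the dimension of the space.\<close>

lemma card_degrees_dominated_less:
  assumes "finite E" "dominated E I g \<subset> dominated E I f"
  shows "card (degree ` (dominated E I g - {0})) < card (degree ` (dominated E I f - {0}))"
proof (rule psubset_card_mono)
  have "degree ` (dominated E I f - {0}) \<subseteq> E"
    by (force simp: dominated_def poly_supp_def)
  then show "finite (degree ` (dominated E I f - {0}))"
    using assms(1) finite_subset by blast
  have "degree ` (dominated E I g - {0}) \<noteq> degree ` (dominated E I f - {0})"
  proof
    assume eq: "degree ` (dominated E I g - {0}) = degree ` (dominated E I f - {0})"
    \<comment> \<open>With equal degree sets, the leading term of \<open>w\<close> can be cancelled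
      by an element of the smaller space; induction on the degree handles the remainder.\<close>
    have "w \<in> dominated E I g" if "w \<in> dominated E I f" for w
      using that
    proof (induction "degree w" arbitrary: w rule: less_induct)
      case less
      show ?case
      proof (cases "w = 0")
        case False
        then have "degree w \<in> degree ` (dominated E I g - {0})"
          using less.prems eq by blast
        then obtain w' where "degree w = degree w'" "w' \<in> dominated E I g - {0}"
          by (rule imageE)
        then have w': "w' \<in> dominated E I g" "w' \<noteq> 0" "degree w' = degree w"
          by simp_all
        define c where "c = lead_coeff w / lead_coeff w'"
        define z where "z = w - smult c w'"
        have "z \<in> dominated E I f"
          unfolding z_def using less.prems w' assms(2)
          by (intro dominated_diff dominated_smult) auto
        have "coeff w' (degree w) \<noteq> 0"
          using w'(2,3) by (metis leading_coeff_0_iff)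
        then have lc: "coeff z (degree w) = 0"
          using w'(3) by (simp add: z_def c_def)
        have "degree z \<le> degree w"
          unfolding z_def using w' by (intro degree_diff_le) (auto intro: order_trans[OF degree_smult_le])
        then have "z = 0 \<or> degree z < degree w"
          using lc by (metis le_neq_implies_less leading_coeff_0_iff)
        then have "z \<in> dominated E I g"
          using less.hyps \<open>z \<in> dominated E I f\<close> dominated_zero by blast
        then have "z + smult c w' \<in> dominated E I g"
          using w' by (intro dominated_add dominated_smult)
        then show ?thesis by (simp add: z_def)
      qed (simp add: dominated_zero)
    qed
    with assms(2) show False by blast
  qed
  then show "degree ` (dominated E I g - {0}) \<subset> degree ` (dominated E I f - {0})"
    using assms(2) by blast
qed

text \<open>Choose \<open>S\<close> as the supremum of \<open>g / f\<close> over the points where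
  \<open>f\<close> is positive. Then \<open>S f - g\<close> is nonnegative on \<open>I\<close> but
  no longer dominates \<open>f\<close>, so its dominated space is strictly smaller.\<close>

lemma dominated_sup_ratio:
  assumes "infinite I" "f \<noteq> 0" "\<And>x. x \<in> I \<Longrightarrow> poly f x \<ge> 0" "poly_supp f \<subseteq> E"
    and "g \<in> dominated E I f"
  obtains S where "\<And>x. x \<in> I \<Longrightarrow> poly (smult S f - g) x \<ge> 0"
    and "dominated E I (smult S f - g) \<subset> dominated E I f"
proof -
  define J where "J = {x\<in>I. poly f x > 0}"
  have "J \<noteq> {}"
    using poly_eq_if_eq_on_infinite[of I f 0] assms(1-3) by (force simp: J_def)
  obtain c where c: "\<And>x. x \<in> I \<Longrightarrow> \<bar>poly g x\<bar> \<le> c * poly f x"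
    using assms(5) by (auto simp: dominated_def)
  define r where "r x = poly g x / poly f x" for x
  define S where "S = Sup (r ` J)"
  have bdd: "bdd_above (r ` J)"
    by (rule bdd_aboveI[of _ c]) (use c in \<open>force simp: J_def r_def divide_simps\<close>)
  have nonneg: "poly (smult S f - g) x \<ge> 0" if "x \<in> I" for x
  proof (cases "x \<in> J")
    case True
    then have "r x \<le> S" unfolding S_def using bdd by (intro cSUP_upper)
    with True show ?thesis by (auto simp: J_def r_def divide_simps)
  next
    case False
    then have "poly f x = 0" using assms(3)[OF that] that by (auto simp: J_def)
    then show ?thesis using c[OF that] by simp
  qed
  have refl: "f \<in> dominated E I f" using assms by (intro dominated_refl) auto
  have sub: "dominated E I (smult S f - g) \<subseteq> dominated E I f"
    using assms(5) nonneg refl by (intro dominated_trans dominated_diff dominated_smult)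
  \<comment> \<open>Domination with constant \<open>d\<close> would give
    \<open>g / f \<le> S - 1 / d\<close> wherever \<open>f\<close> is positive, contradicting the
    choice of \<open>S\<close>.\<close>
  have "f \<notin> dominated E I (smult S f - g)"
  proof
    assume "f \<in> dominated E I (smult S f - g)"
    then obtain d where d: "\<And>x. x \<in> I \<Longrightarrow> \<bar>poly f x\<bar> \<le> d * poly (smult S f - g) x"
      by (auto simp: dominated_def)
    have dpos: "d > 0"
    proof -
      obtain x where x: "x \<in> J" using \<open>J \<noteq> {}\<close> by blast
      then have "0 < d * poly (smult S f - g) x" using d[of x] by (auto simp: J_def)
      moreover have "poly (smult S f - g) x \<ge> 0" using nonneg x by (auto simp: J_def)
      ultimately show ?thesis by (auto simp: zero_less_mult_iff)
    qed
    have "r x \<le> S - 1 / d" if "x \<in> J" for x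
    proof -
      have "poly f x > 0" "poly f x \<le> d * (S * poly f x - poly g x)"
        using that d[of x] by (auto simp: J_def)
      then show ?thesis using dpos by (simp add: r_def field_simps)
    qed
    then have "S \<le> S - 1 / d" unfolding S_def using \<open>J \<noteq> {}\<close> by (intro cSUP_least)
    then show False using dpos by simp
  qed
  with refl sub show ?thesis using that nonneg by blast
qed

text \<open>If \<open>g\<close> is dominated by \<open>f\<close> but not a multiple of it, then \<open>f\<close> is a positive multiple of the
  sum of \<open>S f - g\<close> and \<open>S' f + g\<close> with \<open>S\<close>, \<open>S'\<close> minimal, and both summands dominate strictly less.\<close>

lemma extremal_decomposition:
  assumes "finite E" "infinite I"
    and C: "0 \<in> C" "\<And>f g. f \<in> C \<Longrightarrow> g \<in> C \<Longrightarrow> f + g \<in> C"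
      "\<And>c f. c \<ge> 0 \<Longrightarrow> f \<in> C \<Longrightarrow> smult c f \<in> C"
    and extremal: "\<And>f. f \<noteq> 0 \<Longrightarrow> poly_supp f \<subseteq> E \<Longrightarrow> (\<And>x. x \<in> I \<Longrightarrow> poly f x \<ge> 0) \<Longrightarrow>
      (\<And>g. g \<in> dominated E I f \<Longrightarrow> \<exists>c. g = smult c f) \<Longrightarrow> f \<in> C"
    and "poly_supp f \<subseteq> E" "\<And>x. x \<in> I \<Longrightarrow> poly f x \<ge> 0"
  shows "f \<in> C"
  using assms(7,8)
proof (induction "card (degree ` (dominated E I f - {0}))" arbitrary: f rule: less_induct)
  case less
  show ?case
  proof (cases "f \<noteq> 0 \<and> (\<exists>g\<in>dominated E I f. \<nexists>c. g = smult c f)")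
    case False
    then show ?thesis using C(1) extremal[of f] less.prems by blast
  next
    case True
    then obtain g where g: "g \<in> dominated E I f" "\<nexists>c. g = smult c f" and "f \<noteq> 0"
      by blast
    have ng: "- g \<in> dominated E I f" using dominated_smult[OF g(1), of "-1"] by simp
    obtain S where S: "\<And>x. x \<in> I \<Longrightarrow> poly (smult S f - g) x \<ge> 0"
      "dominated E I (smult S f - g) \<subset> dominated E I f"
      using dominated_sup_ratio[OF assms(2) \<open>f \<noteq> 0\<close> less.prems(2,1) g(1)] by blast
    obtain T where T: "\<And>x. x \<in> I \<Longrightarrow> poly (smult T f - (- g)) x \<ge> 0"
      "dominated E I (smult T f - (- g)) \<subset> dominated E I f"
      using dominated_sup_ratio[OF assms(2) \<open>f \<noteq> 0\<close> less.prems(2,1) ng] by blast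
    have supp: "poly_supp (smult a f - h) \<subseteq> E" if "h \<in> dominated E I f" for a h
      using that less.prems(1) poly_supp_diff[of "smult a f" h] poly_supp_smult[of a f]
      by (auto simp: dominated_def)
    have "smult S f - g \<in> C"
      using card_degrees_dominated_less[OF assms(1) S(2)] supp[OF g(1)] S(1) by (rule less.hyps)
    moreover have "smult T f - (- g) \<in> C"
      using card_degrees_dominated_less[OF assms(1) T(2)] supp[OF ng] T(1) by (rule less.hyps)
    ultimately have "smult S f - g + (smult T f - (- g)) \<in> C" by (rule C(2))
    then have sum: "smult (S + T) f \<in> C" by (simp add: smult_add_left)
    \<comment> \<open>The sum of the two nonnegative polynomials is \<open>(S + T) f\<close>. If
      \<open>S + T\<close> were not positive, both would vanish on \<open>I\<close>, making
      \<open>g\<close> a multiple of \<open>f\<close>.\<close>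
    have "S + T > 0"
    proof (rule ccontr)
      assume "\<not> S + T > 0"
      have "poly g x = poly (smult S f) x" if "x \<in> I" for x
      proof -
        have "(S + T) * poly f x \<le> 0"
          using \<open>\<not> S + T > 0\<close> less.prems(2)[OF that] by (intro mult_nonpos_nonneg) auto
        then show ?thesis using S(1)[OF that] T(1)[OF that] by (simp add: distrib_right)
      qed
      then have "g = smult S f" by (rule poly_eq_if_eq_on_infinite[OF assms(2)])
      then show False using g(2) by blast
    qed
    have "smult (1 / (S + T)) (smult (S + T) f) \<in> C"
      by (rule C(3)[OF _ sum]) (use \<open>S + T > 0\<close> in simp)
    moreover have "smult (1 / (S + T)) (smult (S + T) f) = f"
      using \<open>S + T > 0\<close> by simp
    ultimately show ?thesis by (simp only:)
  qed
qed


section \<open>The shape of extremal elements\<close>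

text \<open>The residues modulo \<open>q\<close> of the monomials with exponent in \<open>A\<close>
  lie in a space of dimension at most \<open>degree q\<close>, so they satisfy a linear relation;
  the same combination of monomials is divisible by \<open>q\<close>.\<close>

lemma exists_multiple_with_supp:
  assumes "q \<noteq> 0" "finite A" "degree q < card A"
  obtains g where "g \<noteq> 0" "poly_supp g \<subseteq> A" "q dvd g"
proof -
  interpret vector_space "smult :: real \<Rightarrow> real poly \<Rightarrow> real poly"
    by (rule vector_space_smult)
  define b where "b e = monom 1 e mod q" for e :: nat
  define T :: "real poly set" where "T = monom 1 ` {..<degree q}"
  have dvd_b: "q dvd monom 1 e - b e" for e
    unfolding b_def by (rule dvd_minus_mod)
  show ?thesis
  \<comment> \<open>Linear dependence is a property of sets, so coinciding residues are treated
    separately: there a difference of two monomials suffices.\<close>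
  proof (cases "inj_on b A")
    case False
    then obtain e e' where e: "e \<in> A" "e' \<in> A" "e \<noteq> e'" "b e = b e'"
      by (auto simp: inj_on_def)
    show ?thesis
    proof (rule that)
      have "coeff (monom 1 e - monom 1 e' :: real poly) e = 1" using e by simp
      then show "monom 1 e - monom 1 e' \<noteq> (0 :: real poly)" by force
      show "poly_supp (monom 1 e - monom 1 e') \<subseteq> A"
        using e by (auto simp: poly_supp_def split: if_splits)
      show "q dvd monom 1 e - monom 1 e'"
        using dvd_diff[OF dvd_b[of e] dvd_b[of e']] e by simp
    qed
  next
    case True
    have "b e \<in> span T" for e
    proof (cases "b e = 0")
      case False
      then have deg: "degree (b e) < degree q"
        using assms(1) unfolding b_def by (intro degree_mod_less')
      have "b e = (\<Sum>i\<le>degree (b e). smult (coeff (b e) i) (monom 1 i))"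
        using poly_as_sum_of_monoms[of "b e"] by (simp add: smult_monom)
      also have "\<dots> \<in> span T"
        using deg by (intro span_sum span_scale span_base) (auto simp: T_def)
      finally show ?thesis .
    qed (simp add: span_zero)
    moreover have "card T \<le> degree q"
      unfolding T_def using card_image_le[of "{..<degree q}"] by simp
    moreover have "card (b ` A) = card A"
      using True by (rule card_image)
    ultimately have "dependent (b ` A)"
      using independent_span_bound[of T "b ` A"] assms(3) by (force simp: T_def)
    then obtain w where w: "\<exists>v\<in>b ` A. w v \<noteq> 0" "(\<Sum>v\<in>b ` A. smult (w v) v) = 0"
      using dependent_finite[of "b ` A"] assms(2) by auto
    define g where "g = (\<Sum>e\<in>A. smult (w (b e)) (monom 1 e))"
    have coeff_g: "coeff g i = (if i \<in> A then w (b i) else 0)" for i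
    proof -
      have "coeff g i = (\<Sum>e\<in>A. if e = i then w (b e) else 0)"
        unfolding g_def coeff_sum by (intro sum.cong) auto
      then show ?thesis using assms(2) by simp
    qed
    show ?thesis
    proof (rule that)
      show "g \<noteq> 0" using w(1) coeff_g by (metis coeff_0 imageE)
      show "poly_supp g \<subseteq> A" by (auto simp: poly_supp_def coeff_g)
      have "(\<Sum>e\<in>A. smult (w (b e)) (b e)) = 0"
        using w(2) sum.reindex[OF True, of "\<lambda>v. smult (w v) v"] by simp
      then have "g = (\<Sum>e\<in>A. smult (w (b e)) (monom 1 e - b e))"
        by (simp add: g_def smult_diff_right sum_subtractf)
      then show "q dvd g" using dvd_b by (auto intro!: dvd_sum dvd_smult)
    qed
  qed
qed

section \<open>Boundedness of ratios of polynomials\<close>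

lemma poly_ratio_bounded_Icc:
  fixes r u :: "real poly"
  assumes "\<And>x. x \<in> {0..1} \<Longrightarrow> poly u x > 0"
  shows "\<exists>c. \<forall>x\<in>{0..1}. \<bar>poly r x\<bar> \<le> c * poly u x"
proof -
  have "\<forall>x. 0 \<le> x \<and> x \<le> 1 \<longrightarrow> isCont (\<lambda>x. \<bar>poly r x\<bar> / poly u x) x"
    using assms by (fastforce intro!: continuous_intros)
  then obtain M where "\<forall>x. 0 \<le> x \<and> x \<le> 1 \<longrightarrow> \<bar>poly r x\<bar> / poly u x \<le> M"
    using isCont_bounded[of 0 1 "\<lambda>x. \<bar>poly r x\<bar> / poly u x"] by auto
  then show ?thesis
    using assms by (intro exI[of _ M]) (simp add: pos_divide_le_eq)
qed

text \<open>On \<open>[1, \<infinity>)\<close> the substitution of \<open>1 / x\<close> for \<open>x\<close> reduces the claim to \<open>(0, 1]\<close>.\<close>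

lemma poly_ratio_bounded_atLeast:
  fixes r u :: "real poly"
  assumes pos: "\<And>x. x \<in> {0..} \<Longrightarrow> poly u x > 0" and deg: "degree r \<le> degree u"
  shows "\<exists>c. \<forall>x\<in>{0..}. \<bar>poly r x\<bar> \<le> c * poly u x"
proof -
  obtain c where c: "\<And>x. 0 \<le> x \<Longrightarrow> x \<le> 1 \<Longrightarrow> \<bar>poly r x\<bar> \<le> c * poly u x"
    using poly_ratio_bounded_Icc[of u r] pos by (metis atLeastAtMost_iff atLeast_iff)
  \<comment> \<open>The extra power of \<open>t\<close> gives \<open>r'\<close> the value
    \<open>y ^ degree u * poly r (1 / y)\<close> at \<open>y > 0\<close>, matching the scaling of
    the reflected \<open>u\<close>.\<close>
  define r' where "r' = monom 1 (degree u - degree r) * reflect_poly r"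
  \<comment> \<open>This is the value of the reflected \<open>u\<close> at 0, where positivity does
    not follow by substitution. A negative leading coefficient would make \<open>u\<close> negative
    far out.\<close>
  have "lead_coeff u > 0"
  proof (rule ccontr)
    assume "\<not> lead_coeff u > 0"
    moreover have "u \<noteq> 0" using pos[of 0] by auto
    ultimately have "0 < lead_coeff (- u)" by (simp add: not_less le_less)
    then obtain N where "\<forall>x\<ge>N. lead_coeff (- u) \<le> poly (- u) x"
      using poly_pinfty_gt_lc by blast
    then have "poly (- u) (max N 0) > 0"
      using \<open>0 < lead_coeff (- u)\<close> by (smt (verit) max.cobounded1)
    then show False using pos[of "max N 0"] by simp
  qed
  have pos': "poly (reflect_poly u) x > 0" if "0 \<le> x" for x
    using \<open>lead_coeff u > 0\<close> pos[of "inverse x"] that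
    by (cases "x = 0") (simp_all add: poly_reflect_poly_nz)
  obtain c' where c': "\<And>x. 0 \<le> x \<Longrightarrow> x \<le> 1 \<Longrightarrow> \<bar>poly r' x\<bar> \<le> c' * poly (reflect_poly u) x"
    using poly_ratio_bounded_Icc[of "reflect_poly u" r'] pos' by (metis atLeastAtMost_iff)
  have "\<bar>poly r x\<bar> \<le> c' * poly u x" if "x \<ge> 1" for x
  proof -
    define y where "y = inverse x"
    have y: "0 < y" "y \<le> 1" using that by (auto simp: y_def field_simps)
    have "y ^ degree u = y ^ (degree u - degree r) * y ^ degree r"
      using deg by (simp flip: power_add)
    then have "poly r' y = y ^ degree u * poly r x"
      using y by (simp add: r'_def poly_monom poly_reflect_poly_nz y_def)
    moreover have "poly (reflect_poly u) y = y ^ degree u * poly u x"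
      using y by (simp add: poly_reflect_poly_nz y_def)
    ultimately have "y ^ degree u * \<bar>poly r x\<bar> \<le> y ^ degree u * (c' * poly u x)"
      using c'[of y] y by (simp add: abs_mult mult.left_commute)
    then show ?thesis using y by simp
  qed
  then have "\<bar>poly r x\<bar> \<le> max c c' * poly u x" if "x \<in> {0..}" for x
  proof (cases "x \<le> 1")
    case True
    then have "\<bar>poly r x\<bar> \<le> c * poly u x" using c that by simp
    also have "\<dots> \<le> max c c' * poly u x"
      using pos[OF that] by (intro mult_right_mono) auto
    finally show ?thesis .
  next
    case False
    then have "\<bar>poly r x\<bar> \<le> c' * poly u x"
      using \<open>\<And>x. x \<ge> 1 \<Longrightarrow> \<bar>poly r x\<bar> \<le> c' * poly u x\<close> by simp
    also have "\<dots> \<le> max c c' * poly u x"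
      using pos[OF that] by (intro mult_right_mono) auto
    finally show ?thesis .
  qed
  then show ?thesis by blast
qed

section \<open>Factorization of polynomials that are nonnegative on an interval\<close>

lemma poly_nonneg_cofactor:
  fixes l h :: "real poly"
  assumes I: "I = {0..1} \<or> I = {0..}"
    and "\<And>y. y \<in> I \<Longrightarrow> poly (l * h) y \<ge> 0" "\<And>y. y \<in> I \<Longrightarrow> y \<noteq> x \<Longrightarrow> poly l y > 0" "y \<in> I"
  shows "poly h y \<ge> 0"
proof (cases "y = x")
  case False
  then show ?thesis using assms(2)[of y] assms(3)[of y] assms(4) by (simp add: zero_le_mult_iff)
next
  case True
  show ?thesis
  proof (rule ccontr)
    assume "\<not> poly h y \<ge> 0"
    moreover have "poly h \<midarrow>x\<rightarrow> poly h x" using poly_isCont isCont_def by blast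
    ultimately obtain d where d: "d > 0" "\<And>z. z \<noteq> x \<Longrightarrow> \<bar>z - x\<bar> < d \<Longrightarrow> poly h z < 0"
      using LIM_D[of "poly h" "poly h x" x "- poly h x"] True by fastforce
    \<comment> \<open>A point of \<open>I\<close> near \<open>x\<close> but different from it, where
      \<open>h\<close> is still negative by continuity while \<open>l\<close> is positive. The caps
      \<open>1 - x\<close> and \<open>1 / 2\<close> keep \<open>z\<close> inside
      \<open>I\<close>.\<close>
    define z where "z = (if x < 1 then x + min (d / 2) (1 - x) else x - min (d / 2) (1 / 2))"
    have "z \<in> I" "z \<noteq> x" "\<bar>z - x\<bar> < d"
      using I assms(4) True d(1) by (auto simp: z_def min_def)
    then show False
      using d(2)[of z] assms(2)[of z] assms(3)[of z] by (simp add: zero_le_mult_iff)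
  qed
qed

text \<open>Roots in \<open>I\<close> are divided out one after another, by induction on the degree.
  A root at 0 contributes \<open>t\<close>, the right endpoint 1 of the bounded interval contributes
  \<open>1 - t\<close>, and an interior root is at least double, so it contributes a square.\<close>

lemma poly_nonneg_factorization:
  assumes I: "I = {0..1} \<or> I = {0..}"
    and "f \<noteq> 0" "\<And>x. x \<in> I \<Longrightarrow> poly f x \<ge> 0"
  shows "\<exists>p b a u. f = p ^ 2 * [:1, -1:] ^ b * (monom 1 a * u) \<and> sign_gaining p \<and>
           (I = {0..} \<longrightarrow> b = 0) \<and> (\<forall>x\<in>I. poly u x > 0)"
  using assms(2,3)
proof (induction "degree f" arbitrary: f rule: less_induct)
  case less
  \<comment> \<open>The induction hypothesis for the cofactor of any nonconstant \<open>l\<close>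
    that is positive on \<open>I\<close> away from one point.\<close>
  have step: "\<exists>p b a u. h = p ^ 2 * [:1, -1:] ^ b * (monom 1 a * u) \<and> sign_gaining p \<and>
           (I = {0..} \<longrightarrow> b = 0) \<and> (\<forall>x\<in>I. poly u x > 0)"
    if "f = l * h" "degree l > 0" "\<And>y. y \<in> I \<Longrightarrow> y \<noteq> x \<Longrightarrow> poly l y > 0" for l h x
  proof (rule less.hyps)
    show "h \<noteq> 0" using that(1) less.prems(1) by auto
    then show "degree h < degree f"
      using that(1,2) less.prems(1) by (simp add: degree_mult_eq)
    have "\<And>y. y \<in> I \<Longrightarrow> poly (l * h) y \<ge> 0"
      using less.prems(2) that(1) by simp
    then show "poly h y \<ge> 0" if "y \<in> I" for y
      using \<open>\<And>y. y \<in> I \<Longrightarrow> y \<noteq> x \<Longrightarrow> poly l y > 0\<close> \<open>y \<in> I\<close>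
      by (rule poly_nonneg_cofactor[OF I])
  qed
  show ?case
  proof (cases "\<forall>x\<in>I. poly f x > 0")
    case True
    show ?thesis
      by (rule exI[of _ 1], rule exI[of _ 0], rule exI[of _ 0], rule exI[of _ f]) (use True in simp)
  next
    case False
    then obtain x where "x \<in> I" "\<not> poly f x > 0" by blast
    then have x: "x \<in> I" "poly f x = 0" using less.prems(2)[of x] by simp_all
    then obtain g where g: "f = [:-x, 1:] * g" by (metis dvdE poly_eq_0_iff_dvd)
    consider "x = 0" | "x = 1" "I = {0..1}" | "x > 0" "x = 1 \<longrightarrow> I = {0..}"
    proof -
      have "x \<ge> 0" using x(1) I by auto
      then consider "x = 0" | "x > 0" by linarith
      then show thesis using that I by cases blast+
    qed
    then show ?thesis
    proof cases
      case 1
      have "poly [:-x, 1:] y > 0" if "y \<in> I" "y \<noteq> 0" for y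
        using 1 I that by auto
      then have "\<exists>p b a u. g = p ^ 2 * [:1, -1:] ^ b * (monom 1 a * u) \<and>
          sign_gaining p \<and> (I = {0..} \<longrightarrow> b = 0) \<and> (\<forall>x\<in>I. poly u x > 0)"
        by (intro step[OF g, of 0]) simp_all
      then obtain p b a u where *: "g = p ^ 2 * [:1, -1:] ^ b * (monom 1 a * u)" "sign_gaining p"
           "I = {0..} \<longrightarrow> b = 0" "\<forall>x\<in>I. poly u x > 0"
        by blast
      have "f = [:0, 1:] * g" using g 1 by simp
      also have "\<dots> = p ^ 2 * [:1, -1:] ^ b * (([:0, 1:] * monom 1 a) * u)"
        unfolding *(1) by (simp only: mult_ac)
      also have "[:0, 1:] * monom 1 a = (monom 1 (Suc a) :: real poly)"
        by (simp add: monom_Suc)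
      finally have "f = p ^ 2 * [:1, -1:] ^ b * (monom 1 (Suc a) * u)" .
      with * show ?thesis by blast
    next
      case 2
      \<comment> \<open>The sign is moved to the cofactor so that the split-off factor is positive
        on the rest of \<open>I\<close>.\<close>
      have "f = [:1, -1:] * (- g)" using 2 g by simp
      have "poly [:1, -1:] y > 0" if "y \<in> I" "y \<noteq> 1" for y
        using 2 that by auto
      then have "\<exists>p b a u. - g = p ^ 2 * [:1, -1:] ^ b *
          (monom 1 a * u) \<and> sign_gaining p \<and> (I = {0..} \<longrightarrow> b = 0) \<and> (\<forall>x\<in>I. poly u x > 0)"
        by (intro step[OF \<open>f = [:1, -1:] * (- g)\<close>, of 1]) simp_all
      then obtain p b a u where *: "- g = p ^ 2 * [:1, -1:] ^ b * (monom 1 a * u)" "sign_gaining p"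
           "I = {0..} \<longrightarrow> b = 0" "\<forall>x\<in>I. poly u x > 0"
        by blast
      have "f = p ^ 2 * [:1, -1:] ^ Suc b * (monom 1 a * u)"
        using \<open>f = _ * (- g)\<close> unfolding *(1) by (simp only: power_Suc mult_ac)
      moreover have "I \<noteq> {0..}"
      proof
        assume "I = {0..}"
        then have "2 \<in> I" by simp
        then show False using 2 by simp
      qed
      ultimately show ?thesis using * by blast
    next
      case 3
      \<comment> \<open>A radius for which the neighbourhood of \<open>x\<close> stays in
        \<open>I\<close>. Thus \<open>x\<close> is a local minimum of \<open>f\<close>, the
        derivative vanishes there, and the root is at least double.\<close>
      define d where "d = (if x = 1 \<or> I = {0..} then x else min x (1 - x))"
      have "0 < d" using 3 x(1) I by (auto simp: d_def)
      moreover have "poly f x \<le> poly f y" if "\<bar>x - y\<bar> < d" for y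
      proof -
        have "d \<le> x" by (simp add: d_def)
        then have "y \<ge> 0" using that by linarith
        moreover have "y \<le> 1" if "I \<noteq> {0..}"
        proof -
          have "d \<le> 1 - x" using that 3(2) by (auto simp: d_def)
          then show ?thesis using \<open>\<bar>x - y\<bar> < d\<close> by linarith
        qed
        ultimately have "y \<in> I" using I by (cases "I = {0..}") simp_all
        then show ?thesis using less.prems(2) x(2) by simp
      qed
      ultimately have "poly (pderiv f) x = 0"
        using DERIV_local_min[OF poly_DERIV] by blast
      moreover have "poly (pderiv f) x = poly g x"
        unfolding g by (simp add: pderiv_mult pderiv_pCons del: mult_pCons_left)
      ultimately have "poly g x = 0" by simp
      then obtain h where "g = [:-x, 1:] * h" by (metis dvdE poly_eq_0_iff_dvd)
      then have f: "f = [:-x, 1:] ^ 2 * h" unfolding g by (simp only: power2_eq_square mult.assoc)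
      have "poly ([:-x, 1:] ^ 2) y > 0" if "y \<in> I" "y \<noteq> x" for y
        using that by simp
      moreover have "degree ([:-x, 1:] ^ 2) > 0"
        by (simp add: degree_power_eq)
      ultimately have "\<exists>p b a u. h = p ^ 2 * [:1, -1:] ^ b *
          (monom 1 a * u) \<and> sign_gaining p \<and> (I = {0..} \<longrightarrow> b = 0) \<and> (\<forall>x\<in>I. poly u x > 0)"
        by (intro step[OF f, of x])
      then obtain p b a u where *: "h = p ^ 2 * [:1, -1:] ^ b * (monom 1 a * u)" "sign_gaining p"
           "I = {0..} \<longrightarrow> b = 0" "\<forall>x\<in>I. poly u x > 0"
        by blast
      have "f = ([:-x, 1:] * p) ^ 2 * [:1, -1:] ^ b * (monom 1 a * u)"
        unfolding f *(1) by (simp only: power_mult_distrib mult_ac)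
      moreover have "sign_gaining ([:-x, 1:] * p)"
        using * 3 by (intro sign_gaining_mult sign_gaining_linear)
      ultimately show ?thesis using * by blast
    qed
  qed
qed

text \<open>By a dimension count the fixed factor \<open>q\<close> of an extremal \<open>f\<close> has one root less than \<open>f\<close> has
  terms. This is the maximum allowed by Descartes' rule, so the cofactor has no sign change.\<close>

lemma extremal_shape:
  assumes I: "I = {0..1} \<or> I = {0..}"
    and "f \<noteq> 0" "\<And>x. x \<in> I \<Longrightarrow> poly f x \<ge> 0"
    and extremal: "\<And>g. g \<in> dominated (poly_supp f) I f \<Longrightarrow> \<exists>c. g = smult c f"
  shows "\<exists>p b h. f = p ^ 2 * [:1, -1:] ^ b * h \<and> b \<le> 1 \<and> (I = {0..} \<longrightarrow> b = 0) \<and>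
    (\<forall>i. coeff h i \<ge> 0) \<and> 2 * degree p + b < card (poly_supp f)"
proof -
  obtain p0 b0 a u where pu: "f = p0 ^ 2 * [:1, -1:] ^ b0 * (monom 1 a * u)" "sign_gaining p0"
     "I = {0..} \<longrightarrow> b0 = 0" "\<forall>x\<in>I. poly u x > 0"
    using poly_nonneg_factorization[OF assms(1-3)] by blast
  \<comment> \<open>Pairs of factors \<open>1 - t\<close> are absorbed into the square, leaving only
    their parity \<open>b\<close> as exponent.\<close>
  define p where "p = p0 * [:1, -1:] ^ (b0 div 2)"
  define b where "b = b0 mod 2"
  define q where "q = p ^ 2 * [:1, -1:] ^ b"
  define h where "h = monom 1 a * u"
  have b: "b \<le> 1" "I = {0..} \<Longrightarrow> b = 0" using pu(3) by (auto simp: b_def)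
  have "[:1, -1:] ^ b0 = ([:1, -1:] ^ (b0 div 2)) ^ 2 * ([:1, -1:] ^ b :: real poly)"
    unfolding b_def power_mult[symmetric] power_add[symmetric] by simp
  then have fqh: "f = q * h"
    unfolding pu(1) q_def p_def h_def power_mult_distrib by (simp only: mult_ac)
  have "sign_gaining p"
    unfolding p_def using pu(2) sign_gaining_one_minus by (intro sign_gaining_mult sign_gaining_power)
  then have sg: "sign_gaining q"
    unfolding q_def using sign_gaining_one_minus by (intro sign_gaining_mult sign_gaining_power)
  have nz: "p \<noteq> 0" "q \<noteq> 0" "h \<noteq> 0" "u \<noteq> 0"
    using sg \<open>sign_gaining p\<close> assms(2) fqh by (auto simp: sign_gaining_def h_def)
  have deg_q: "degree q = 2 * degree p + b"
    using nz(1) by (simp add: q_def degree_mult_eq degree_power_eq)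
  have q_nonneg: "poly q x \<ge> 0" if "x \<in> I" for x
    using that I b by (auto simp: q_def)
  have f_eq: "f = monom 1 a * (q * u)"
    using fqh by (simp add: h_def mult_ac)
  have "card (poly_supp f) \<le> Suc (degree q)"
  proof (rule ccontr)
    assume many: "\<not> card (poly_supp f) \<le> Suc (degree q)"
    \<comment> \<open>The exponents of \<open>f\<close> lowered by \<open>a\<close>, without the top
      one. More than \<open>degree q\<close> remain, and omitting the top exponent keeps the
      resulting \<open>g\<close> from being a nonzero multiple of \<open>f\<close>.\<close>
    define A where "A = (\<lambda>e. e - a) ` (poly_supp f - {degree f})"
    have supp_ge: "a \<le> e" if "e \<in> poly_supp f" for e
      using that by (auto simp: f_eq poly_supp_def coeff_monom_mult split: if_splits)
    have "inj_on (\<lambda>e. e - a) (poly_supp f - {degree f})"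
      using supp_ge by (intro inj_onI) (metis DiffD1 eq_diff_iff)
    then have "card A = card (poly_supp f) - 1"
      using assms(2) by (simp add: A_def card_image poly_supp_def)
    then have "degree q < card A" using many by simp
    then obtain g0 where g0: "g0 \<noteq> 0" "poly_supp g0 \<subseteq> A" "q dvd g0"
      using exists_multiple_with_supp[OF nz(2), of A] by (auto simp: A_def)
    then obtain r where r: "g0 = q * r" by auto
    define g where "g = monom 1 a * g0"
    have "g \<noteq> 0" "r \<noteq> 0" using g0(1) r by (auto simp: g_def)
    have supp_g: "poly_supp g \<subseteq> poly_supp f - {degree f}"
    proof
      fix i assume "i \<in> poly_supp g"
      then have "a \<le> i" "i - a \<in> A"
        using g0(2) by (auto simp: g_def poly_supp_def coeff_monom_mult split: if_splits)
      then show "i \<in> poly_supp f - {degree f}"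
        using supp_ge by (auto simp: A_def) (metis eq_diff_iff)+
    qed
    have "degree g \<in> poly_supp g" using \<open>g \<noteq> 0\<close> by (simp add: poly_supp_def)
    then have "degree g \<in> poly_supp f" using supp_g by blast
    then have "degree g \<le> degree f"
      by (intro le_degree) (simp add: poly_supp_def)
    \<comment> \<open>On the unbounded interval this degree bound makes \<open>r / u\<close>
      bounded, and with it \<open>g / f\<close>.\<close>
    then have "degree r \<le> degree u"
      using nz \<open>r \<noteq> 0\<close> by (simp add: g_def r f_eq degree_mult_eq degree_monom_eq)
    have "\<exists>c. \<forall>x\<in>I. \<bar>poly r x\<bar> \<le> c * poly u x"
      using I
    proof
      assume "I = {0..1}"
      then show ?thesis
        using pu(4) poly_ratio_bounded_Icc[of u r] by blast
    next
      assume "I = {0..}"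
      then show ?thesis
        using pu(4) poly_ratio_bounded_atLeast[of u r] \<open>degree r \<le> degree u\<close> by blast
    qed
    then obtain c where c: "\<And>x. x \<in> I \<Longrightarrow> \<bar>poly r x\<bar> \<le> c * poly u x"
      by blast
    have "\<bar>poly g x\<bar> \<le> c * poly f x" if "x \<in> I" for x
    proof -
      have "x \<ge> 0" using that I by auto
      then have "x ^ a * poly q x \<ge> 0" using q_nonneg[OF that] by simp
      have "poly g x = (x ^ a * poly q x) * poly r x"
        by (simp add: g_def r poly_monom)
      then have "\<bar>poly g x\<bar> = (x ^ a * poly q x) * \<bar>poly r x\<bar>"
        using \<open>x ^ a * poly q x \<ge> 0\<close> by (simp only: abs_mult[of _ "poly r x"] abs_of_nonneg)
      also have "\<dots> \<le> (x ^ a * poly q x) * (c * poly u x)"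
        using \<open>x ^ a * poly q x \<ge> 0\<close> c[OF that] by (rule mult_left_mono[rotated])
      also have "\<dots> = c * poly f x" by (simp add: f_eq poly_monom)
      finally show ?thesis .
    qed
    then have "g \<in> dominated (poly_supp f) I f"
      using supp_g by (auto simp: dominated_def)
    then obtain c' where c': "g = smult c' f" using extremal by blast
    have "coeff g (degree f) = 0" using supp_g by (auto simp: poly_supp_def)
    then have "c' = 0" using c' assms(2) by simp
    then show False using c' \<open>g \<noteq> 0\<close> by simp
  qed
  \<comment> \<open>The point 1 lies in both intervals, so positivity of \<open>u\<close> there
    decides the sign of the coefficients of \<open>h\<close>.\<close>
  moreover have "poly h 1 > 0" using pu(4) I by (auto simp: h_def poly_monom)
  ultimately have "coeff h i \<ge> 0" for i
    using sign_gaining_cofactor_coeffs[OF sg] fqh by blast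
  moreover have "2 * degree p + b < card (poly_supp f)"
    using sign_gaining_card_supp[OF sg nz(3)] deg_q fqh by simp
  ultimately show ?thesis
    using fqh b unfolding q_def by blast
qed

section \<open>Membership in the sums\<close>

definition poly_cone :: "real poly set \<Rightarrow> bool" where
  "poly_cone C \<longleftrightarrow> 0 \<in> C \<and> (\<forall>f\<in>C. \<forall>g\<in>C. f + g \<in> C) \<and> (\<forall>c\<ge>0. \<forall>f\<in>C. smult c f \<in> C)"

lemma poly_cone_sum:
  "poly_cone C \<Longrightarrow> (\<And>i. i \<in> A \<Longrightarrow> g i \<in> C) \<Longrightarrow> sum g A \<in> C"
  by (induction A rule: infinite_finite_induct) (auto simp: poly_cone_def)

text \<open>Expanding \<open>h\<close> in monomials exhibits \<open>q * h\<close> as a nonnegative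
  combination of the products \<open>monom 1 i * q\<close>.\<close>

lemma poly_cone_mult:
  assumes "poly_cone C" "\<And>i. coeff h i \<ge> 0" "\<And>i. i \<le> degree h \<Longrightarrow> monom 1 i * q \<in> C"
  shows "q * h \<in> C"
proof -
  have "q * h = q * (\<Sum>i\<le>degree h. monom (coeff h i) i)"
    by (simp add: poly_as_sum_of_monoms)
  also have "\<dots> = (\<Sum>i\<le>degree h. smult (coeff h i) (monom 1 i * q))"
    unfolding sum_distrib_left
    by (intro sum.cong refl) (metis mult.commute mult_smult_left smult_monom mult.right_neutral)
  also have "\<dots> \<in> C"
    using assms by (intro poly_cone_sum) (auto simp: poly_cone_def)
  finally show ?thesis .
qed

lemma poly_cone_psd_polys: "poly_cone (psd_polys d)"
  by (auto simp: poly_cone_def psd_polys_def intro: degree_add_le order_trans[OF degree_smult_le])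

lemma square_in_psd_polys: "degree p \<le> k \<Longrightarrow> p ^ 2 \<in> psd_polys (2 * k)"
  by (auto simp: psd_polys_def intro: order_trans[OF degree_power_le])

lemma shifted_sum_iff:
  "f \<in> shifted_sum r S \<longleftrightarrow> (\<exists>g. (\<forall>i\<le>r. g i \<in> S) \<and> f = (\<Sum>i\<le>r. monom 1 i * g i))"
proof
  assume "f \<in> shifted_sum r S"
  then obtain s where s: "\<forall>i\<le>r. s i \<in> monom 1 i *o S" "f = sum s {..r}"
    by (auto simp: shifted_sum_def set_sum_alt)
  then obtain g where g: "\<forall>i\<le>r. g i \<in> S \<and> s i = monom 1 i * g i"
    unfolding elt_set_times_def by (simp add: Bex_def) metis
  then have "f = (\<Sum>i\<le>r. monom 1 i * g i)" unfolding s(2) by (intro sum.cong) auto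
  with g show "\<exists>g. (\<forall>i\<le>r. g i \<in> S) \<and> f = (\<Sum>i\<le>r. monom 1 i * g i)" by blast
next
  assume "\<exists>g. (\<forall>i\<le>r. g i \<in> S) \<and> f = (\<Sum>i\<le>r. monom 1 i * g i)"
  then show "f \<in> shifted_sum r S"
    by (force simp: shifted_sum_def set_sum_alt elt_set_times_def)
qed

lemma poly_cone_shifted_sum:
  assumes "poly_cone S"
  shows "poly_cone (shifted_sum r S)"
  unfolding poly_cone_def
proof (intro conjI ballI allI impI)
  show "0 \<in> shifted_sum r S"
    unfolding shifted_sum_iff using assms
    by (intro exI[of _ "\<lambda>_. 0"]) (auto simp: poly_cone_def)
next
  fix f g assume "f \<in> shifted_sum r S" "g \<in> shifted_sum r S"
  then obtain a b where "\<forall>i\<le>r. a i \<in> S" "f = (\<Sum>i\<le>r. monom 1 i * a i)"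
     "\<forall>i\<le>r. b i \<in> S" "g = (\<Sum>i\<le>r. monom 1 i * b i)"
    unfolding shifted_sum_iff by blast
  then show "f + g \<in> shifted_sum r S"
    unfolding shifted_sum_iff using assms
    by (intro exI[of _ "\<lambda>i. a i + b i"]) (auto simp: poly_cone_def distrib_left sum.distrib)
next
  fix f and c :: real assume "c \<ge> 0" "f \<in> shifted_sum r S"
  then obtain a where "\<forall>i\<le>r. a i \<in> S" "f = (\<Sum>i\<le>r. monom 1 i * a i)"
    unfolding shifted_sum_iff by blast
  moreover have "smult c (\<Sum>i\<le>r. monom 1 i * a i) = (\<Sum>i\<le>r. monom 1 i * smult c (a i))"
    by (induction r) (simp_all add: smult_add_right)
  ultimately show "smult c f \<in> shifted_sum r S"
    unfolding shifted_sum_iff using assms \<open>c \<ge> 0\<close>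
    by (intro exI[of _ "\<lambda>i. smult c (a i)"]) (auto simp: poly_cone_def)
qed

lemma poly_cone_set_plus:
  assumes "poly_cone A" "poly_cone B"
  shows "poly_cone (A + q *o B)"
  unfolding poly_cone_def
proof (intro conjI ballI allI impI)
  have "0 + q * 0 \<in> A + q *o B"
    using assms by (intro set_plus_intro set_times_intro2) (auto simp: poly_cone_def)
  then show "0 \<in> A + q *o B" by simp
next
  fix f g assume "f \<in> A + q *o B" "g \<in> A + q *o B"
  then obtain a b a' b' where "a \<in> A" "a' \<in> A" "b \<in> B" "b' \<in> B" "f = a + q * b" "g = a' + q * b'"
    by (auto simp: elt_set_times_def elim!: set_plus_elim)
  moreover from this have "(a + a') + q * (b + b') \<in> A + q *o B"
    using assms by (intro set_plus_intro set_times_intro2) (auto simp: poly_cone_def)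
  ultimately show "f + g \<in> A + q *o B" by (simp add: algebra_simps)
next
  fix f and c :: real assume "c \<ge> 0" "f \<in> A + q *o B"
  then obtain a b where "a \<in> A" "b \<in> B" "f = a + q * b"
    by (auto simp: elt_set_times_def elim!: set_plus_elim)
  moreover from this have "smult c a + q * smult c b \<in> A + q *o B"
    using assms \<open>c \<ge> 0\<close> by (intro set_plus_intro set_times_intro2) (auto simp: poly_cone_def)
  ultimately show "smult c f \<in> A + q *o B" by (simp add: smult_add_right)
qed

lemma monom_mult_in_shifted_sum:
  assumes "i \<le> r" "g \<in> S" "0 \<in> S"
  shows "monom 1 i * g \<in> shifted_sum r S"
proof -
  have "monom 1 i * g = (\<Sum>j\<le>r. if j = i then monom 1 i * g else 0)"
    using assms(1) by simp
  also have "\<dots> = (\<Sum>j\<le>r. monom 1 j * (if j = i then g else 0))"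
    by (intro sum.cong) auto
  finally show ?thesis
    unfolding shifted_sum_iff using assms by (intro exI[of _ "\<lambda>j. if j = i then g else 0"]) auto
qed

text \<open>Even powers of \<open>t\<close> are moved into the square until the remaining exponent is at most \<open>r\<close>.\<close>

lemma monom_mult_square_in_shifted_sum:
  assumes "j + 2 * degree p \<le> r + 2 * k" "degree p \<le> k" "r > 0 \<or> even j"
  shows "monom 1 j * p ^ 2 \<in> shifted_sum r (psd_polys (2 * k))"
proof -
  \<comment> \<open>The excess of \<open>j\<close> over \<open>r\<close> is halved. If it is odd,
    \<open>i = r - 1\<close> is used, which requires \<open>r > 0\<close>; by parity, the rounded-up
    \<open>e\<close> still satisfies the bound by \<open>k\<close>.\<close>
  obtain i e where ie: "i \<le> r" "j = i + 2 * e" "e + degree p \<le> k"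
  proof (cases "j \<le> r")
    case True
    then show ?thesis using that[of j 0] assms by simp
  next
    case False
    show ?thesis
    proof (cases "even (j - r)")
      case True
      then obtain e where "j - r = 2 * e" by (rule evenE)
      with False assms show ?thesis by (intro that[of r e]) auto
    next
      case odd: False
      then have "r > 0" using assms(3) False by (cases "r = 0") auto
      moreover from odd obtain e where "j - r = 2 * e + 1" by (rule oddE)
      ultimately show ?thesis
        using False assms by (intro that[of "r - 1" "Suc e"]) auto
    qed
  qed
  have "monom 1 j = monom 1 i * (monom 1 e :: real poly) ^ 2"
    by (simp add: ie(2) mult_monom monom_power mult.commute)
  then have "monom 1 j * p ^ 2 = monom 1 i * (monom 1 e * p) ^ 2"
    by (simp add: power_mult_distrib mult_ac)
  moreover have "degree (monom 1 e * p) \<le> k"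
    using ie(3) degree_mult_le[of "monom 1 e" p] by (simp add: degree_monom_eq)
  ultimately show ?thesis
    using ie(1) square_in_psd_polys poly_cone_psd_polys[of "2 * k"]
    by (auto intro!: monom_mult_in_shifted_sum simp: poly_cone_def)
qed

theorem corollary3p15:
  fixes n k :: nat and m :: "nat \<Rightarrow> nat" and V \<Sigma> :: "real poly set"
  assumes "\<And>i j. i < j \<Longrightarrow> j \<le> n \<Longrightarrow> m j < m i"
    and "V = monomial_span (m ` {..n})"
    and "k = n div 2"
    and "m 0 > 2 * k"
    and "\<Sigma> = psd_polys (2 * k)"
  shows "nonneg_polys_on {0..1} V \<subseteq>
           shifted_sum (m 0 - 2 * k) \<Sigma> + [:1, -1:] *o shifted_sum (m 0 - 2 * k - 1) \<Sigma> \<and>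
         nonneg_polys_on {0..} V \<subseteq> shifted_sum (m 0 - 2 * k) \<Sigma>"
proof (intro conjI subsetI)
  define C where "C r = shifted_sum r \<Sigma>" for r
  have cone: "poly_cone (C r)" for r
    unfolding C_def assms(5) by (intro poly_cone_shifted_sum poly_cone_psd_polys)
  have square: "monom 1 j * p ^ 2 \<in> C r"
    if "j + 2 * degree p \<le> r + 2 * k" "degree p \<le> k" "r > 0 \<or> even j" for j p r
    unfolding C_def assms(5) using that by (rule monom_mult_square_in_shifted_sum)
  have m_le: "m i \<le> m 0" if "i \<le> n" for i
    using assms(1)[of 0 i] that by (cases "i = 0") auto
  \<comment> \<open>Both inclusions reduce to this: a cone contains all of \<open>P\<close> once it
    contains the products \<open>t^j p^2 (1 - t)^b\<close> within the stated degree bounds.\<close>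
  have shape: "f \<in> D"
    if I: "I = {0..1} \<or> I = {0..}" and "poly_cone D" "f \<in> nonneg_polys_on I V"
      and D: "\<And>j p b. b \<le> 1 \<Longrightarrow> (I = {0..} \<Longrightarrow> b = 0) \<Longrightarrow> degree p \<le> k \<Longrightarrow>
        j + 2 * degree p + b \<le> m 0 \<Longrightarrow> monom 1 j * (p ^ 2 * [:1, -1:] ^ b) \<in> D" for f I D
  proof (rule extremal_decomposition[of "m ` {..n}" I D])
    show "finite (m ` {..n})" by simp
    show "infinite I"
      using I by (rule disjE) (simp_all add: infinite_Icc infinite_Ici)
    show "poly_supp f \<subseteq> m ` {..n}" "\<And>x. x \<in> I \<Longrightarrow> 0 \<le> poly f x"
      using that(3) assms(2) poly_supp_monomial_span by (auto simp: nonneg_polys_on_def)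
    show "0 \<in> D" "\<And>f g. f \<in> D \<Longrightarrow> g \<in> D \<Longrightarrow> f + g \<in> D"
      "\<And>c f. 0 \<le> c \<Longrightarrow> f \<in> D \<Longrightarrow> smult c f \<in> D"
      using that(2) by (auto simp: poly_cone_def)
    fix f
    assume f: "f \<noteq> 0" "poly_supp f \<subseteq> m ` {..n}" "\<And>x. x \<in> I \<Longrightarrow> 0 \<le> poly f x"
      and ext: "\<And>g. g \<in> dominated (m ` {..n}) I f \<Longrightarrow> \<exists>c. g = smult c f"
    \<comment> \<open>Extremality among all allowed exponents passes to the exponents of
      \<open>f\<close> itself, where the shape result counts terms.\<close>
    have "dominated (poly_supp f) I f \<subseteq> dominated (m ` {..n}) I f"
      using f(2) by (auto simp: dominated_def)
    with ext have ext': "\<And>g. g \<in> dominated (poly_supp f) I f \<Longrightarrow> \<exists>c. g = smult c f" by blast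
    obtain p b h where pbh: "f = p ^ 2 * [:1, -1:] ^ b * h" "b \<le> 1" "I = {0..} \<longrightarrow> b = 0"
      "\<forall>i. coeff h i \<ge> 0" "2 * degree p + b < card (poly_supp f)"
      using extremal_shape[OF I f(1,3) ext'] by blast
    have nz: "p ^ 2 \<noteq> 0" "h \<noteq> 0" using f(1) pbh(1) by auto
    have "card (poly_supp f) \<le> card (m ` {..n})"
      using f(2) by (intro card_mono) auto
    also have "\<dots> \<le> Suc n" using card_image_le[of "{..n}" m] by simp
    \<comment> \<open>From \<open>2 * degree p + b < card (poly_supp f) \<le> n + 1\<close> follows
      \<open>2 * degree p \<le> n\<close>; halving gives \<open>k\<close>.\<close>
    finally have "degree p \<le> k" using pbh(5) assms(3) by simp
    have "degree f \<in> m ` {..n}"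
      using f(1,2) by (auto simp: poly_supp_def)
    then have "degree f \<le> m 0" using m_le by auto
    then have "degree h + (2 * degree p + b) \<le> m 0"
      using nz by (simp add: pbh(1) degree_mult_eq degree_power_eq)
    show "f \<in> D"
      unfolding pbh(1)
    proof (rule poly_cone_mult)
      show "monom 1 j * (p ^ 2 * [:1, -1:] ^ b) \<in> D" if "j \<le> degree h" for j
        using pbh(2,3) \<open>degree p \<le> k\<close> \<open>degree h + _ \<le> m 0\<close> that by (intro D) simp_all
    qed (use that(2) pbh(4) in simp_all)
  qed
  fix f
  show "f \<in> shifted_sum (m 0 - 2 * k) \<Sigma>" if f: "f \<in> nonneg_polys_on {0..} V"
  proof -
    \<comment> \<open>On the half-line no factor \<open>1 - t\<close> occurs, and
      \<open>m 0 > 2 * k\<close> permits either parity of \<open>j\<close>.\<close>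
    have "monom 1 j * (p ^ 2 * [:1, -1:] ^ b) \<in> C (m 0 - 2 * k)"
      if "{0..} = {0::real..} \<Longrightarrow> b = 0" "degree p \<le> k" "j + 2 * degree p + b \<le> m 0"
      for j b :: nat and p :: "real poly"
      using that assms(4) square[of j p "m 0 - 2 * k"] by simp
    with f cone show ?thesis
      using shape[of "{0..}" "C (m 0 - 2 * k)" f] unfolding C_def by blast
  qed
  show "f \<in> shifted_sum (m 0 - 2 * k) \<Sigma> + [:1, -1:] *o shifted_sum (m 0 - 2 * k - 1) \<Sigma>"
    if f: "f \<in> nonneg_polys_on {0..1} V"
  proof -
    define r where "r = m 0 - 2 * k"
    have r: "r > 0" "m 0 = r + 2 * k" using assms(4) by (auto simp: r_def)
    have left: "x \<in> C r + [:1, -1:] *o C (r - 1)" if "x \<in> C r" for x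
      using set_plus_intro[OF that set_times_intro2[of 0 "C (r - 1)" "[:1, -1:]"]] cone
      by (simp add: poly_cone_def)
    have right: "[:1, -1:] * x \<in> C r + [:1, -1:] *o C (r - 1)" if "x \<in> C (r - 1)" for x
      using set_plus_intro[OF _ set_times_intro2[OF that], of 0 "C r" "[:1, -1:]"] cone
      by (simp add: poly_cone_def)
    have "monom 1 j * (p ^ 2 * [:1, -1:] ^ b) \<in> C r + [:1, -1:] *o C (r - 1)"
      if jbp: "b \<le> 1" "degree p \<le> k" "j + 2 * degree p + b \<le> m 0"
      for j b :: nat and p :: "real poly"
    proof (cases "b = 0")
      case True
      then show ?thesis using square[of j p r] jbp r by (intro left) simp
    next
      case False
      then have "b = 1" using jbp(1) by simp
      show ?thesis
      \<comment> \<open>The factor \<open>1 - t\<close> uses up one degree, so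
        \<open>t^j p^2\<close> fits into the sum with \<open>r - 1\<close>, except possibly when
        that sum is \<open>\<Sigma>\<close> alone and \<open>j\<close> is odd.\<close>
      proof (cases "r - 1 > 0 \<or> even j")
        case True
        then have "monom 1 j * p ^ 2 \<in> C (r - 1)"
          using jbp r \<open>b = 1\<close> by (intro square) auto
        from right[OF this] show ?thesis using \<open>b = 1\<close> by (simp add: mult_ac)
      next
        case False
        text \<open>Here \<open>r = 1\<close>, and \<open>t (1 - t) = t (1 - t)\<^sup>2 + (1 - t) t\<^sup>2\<close> gives the representation.\<close>
        have "odd j" using False by simp
        then obtain e where e: "j = 2 * e + 1" by (rule oddE)
        have "r = 1" using False r by simp
        define x y where "x = monom 1 e * p * [:1, -1:]" and "y = monom 1 (Suc e) * p"
        have "degree x \<le> degree (monom 1 e * p) + degree [:1, -1 :: real:]"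
          unfolding x_def by (rule degree_mult_le)
        moreover have "degree (monom 1 e * p) \<le> e + degree p"
          using degree_mult_le[of "monom 1 e" p] by (simp add: degree_monom_eq)
        moreover have "degree y \<le> Suc e + degree p"
          unfolding y_def using degree_mult_le[of "monom 1 (Suc e)" p] by (simp add: degree_monom_eq)
        \<comment> \<open>The degree bound reads
          \<open>2 * (e + degree p + 1) \<le> 2 * k + 1\<close>; by parity,
          \<open>e + degree p + 1 \<le> k\<close>.\<close>
        ultimately have "degree x \<le> k" "degree y \<le> k"
          using jbp \<open>b = 1\<close> r e \<open>r = 1\<close> by auto
        have "monom 1 1 * x ^ 2 \<in> C r" "y ^ 2 \<in> C (r - 1)"
          using \<open>degree x \<le> k\<close> \<open>degree y \<le> k\<close> \<open>r = 1\<close>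
          using square[of 1 x r] square[of 0 y "r - 1"] by simp_all
        then have "monom 1 1 * x ^ 2 + [:1, -1:] * y ^ 2 \<in> C r + [:1, -1:] *o C (r - 1)"
          by (intro set_plus_intro set_times_intro2)
        also have "monom 1 1 * x ^ 2 + [:1, -1:] * y ^ 2 =
            monom 1 j * (p ^ 2 * [:1, -1:] ^ b)"
        proof -
          have *: "T * (M * p * U) ^ 2 + U * (T * M * p) ^ 2 = T * M ^ 2 * (p ^ 2 * U) * (U + T)"
            for T M U :: "real poly"
            by (simp add: power2_eq_square algebra_simps)
          have Suc_e: "monom 1 (Suc e) = monom 1 1 * (monom 1 e :: real poly)"
            by (simp add: mult_monom)
          have "monom 1 (2 * e) = (monom 1 e :: real poly) ^ 2"
            by (simp add: monom_power mult.commute)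
          then have j: "monom 1 j = monom 1 1 * (monom 1 e :: real poly) ^ 2"
            using mult_monom[of "1::real" 1 1 "2 * e"] e by simp
          have one: "[:1, -1:] + monom 1 1 = (1 :: real poly)"
            by (simp add: monom_Suc one_pCons)
          show ?thesis
            unfolding x_def y_def Suc_e * one j \<open>b = 1\<close> by simp
        qed
        finally show ?thesis .
      qed
    qed
    with f poly_cone_set_plus[OF cone cone] have "f \<in> C r + [:1, -1:] *o C (r - 1)"
      using shape[of "{0..1}" "C r + [:1, -1:] *o C (r - 1)" f] by blast
    then show ?thesis by (simp only: C_def r_def)
  qed
qed

end
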